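(* Let $A$ be an Arens regular Banach algebra, $X$ a Banach $A$-bimodule, and $D:A\to X^*$ a surjective derivation. Then $D'':A^{**}\to X^{***}$ is a derivation if and only if for every $x''\in X^{**}$ the mapping $a''\mapsto x''a''$ from $A^{**}$ into $X^{**}$ is weak$^*$-to-weak continuous.
   Context: A derivation from a Banach algebra $B$ into a Banach $B$-bimodule $Y$ is a bounded linear map $D$ with $D(xy)=xD(y)+D(x)y$ for all $x,y\in B$. The dual $Y^*$ of a Banach $B$-bimodule $Y$ is a $B$-bimodule via $\langle by',y\rangle=\langle y',yb\rangle$, $\langle y'b,y\rangle=\langle y',by\rangle$. $D''$ is the second adjoint of $D$. $A^{**}$ carries the first Arens product: $\langle b''a',a\rangle=\langle b'',a'a\rangle$ and $\langle a''b'',a'\rangle=\langle a'',b''a'\rangle$, where $\langle a'a,b\rangle=\langle a',ab\rangle$. $A$ is Arens regular if the first and second Arens products on $A^{**}$ coincide; equivalently $\lim_\alpha\lim_\beta\langle a',a_\alpha b_\beta\rangle=\lim_\beta\lim_\alpha\langle a',a_\alpha b_\beta\rangle$ for all $a'\in A^*$ and all nets $(a_\alpha),(b_\beta)$ in $A$ converging weak$^*$ in $A^{**}$. $X^{**}$ is a Banach $A^{**}$-bimodule via $a''x''=w^*\text{-}\lim_i\lim_j a_ix_j$ and $x''a''=w^*\text{-}\lim_j\lim_i x_ja_i$, for nets $(a_i)\subseteq A$, $(x_j)\subseteq X$ converging weak$^*$ to $a''$, $x''$ (iterated weak$^*$ limits, the inner limit being taken first). $X^{***}$ is the dual $A^{**}$-bimodule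 of $X^{**}$. *)

theory Defs
  imports "HOL-Analysis.Analysis"
begin

section \<open>Complex normed spaces\<close>

class scaleC = scaleR +
  fixes scaleC :: "complex \<Rightarrow> 'a \<Rightarrow> 'a"  (infixr "*\<^sub>C" 75)
  assumes scaleR_scaleC: "scaleR r x = scaleC (complex_of_real r) x"

class complex_vector = scaleC + ab_group_add +
  assumes scaleC_add_right: "c *\<^sub>C (x + y) = c *\<^sub>C x + c *\<^sub>C y"
    and scaleC_add_left: "(c + d) *\<^sub>C x = c *\<^sub>C x + d *\<^sub>C x"
    and scaleC_scaleC: "c *\<^sub>C d *\<^sub>C x = (c * d) *\<^sub>C x"
    and scaleC_one: "1 *\<^sub>C x = x"

class complex_normed_vector = complex_vector + real_normed_vector +
  assumes norm_scaleC: "norm (c *\<^sub>C x) = cmod c * norm x"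

class complex_normed_algebra = complex_normed_vector + real_normed_algebra +
  assumes mult_scaleC_left: "(c *\<^sub>C x) * y = c *\<^sub>C (x * y)"
    and mult_scaleC_right: "x * (c *\<^sub>C y) = c *\<^sub>C (x * y)"

instantiation complex :: complex_normed_vector
begin
definition scaleC_complex :: "complex \<Rightarrow> complex \<Rightarrow> complex"
  where "scaleC_complex c x = c * x"
instance
  by standard (auto simp: scaleC_complex_def scaleR_conv_of_real algebra_simps norm_mult)
end

definition bounded_clinear :: "('a::complex_normed_vector \<Rightarrow> 'b::complex_normed_vector) \<Rightarrow> bool"
  where "bounded_clinear f \<longleftrightarrow> bounded_linear f \<and> (\<forall>c x. f (c *\<^sub>C x) = c *\<^sub>C f x)"

definition bounded_cbilinear ::
  "('a::complex_normed_vector \<Rightarrow> 'b::complex_normed_vector \<Rightarrow> 'c::complex_normed_vector) \<Rightarrow> bool"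
  where "bounded_cbilinear m \<longleftrightarrow> bounded_bilinear m \<and>
    (\<forall>c x y. m (c *\<^sub>C x) y = c *\<^sub>C m x y \<and> m x (c *\<^sub>C y) = c *\<^sub>C m x y)"

lemma bounded_clinearI:
  assumes "\<And>x y. f (x + y) = f x + f y" "\<And>c x. f (c *\<^sub>C x) = c *\<^sub>C f x"
    and "\<And>x. norm (f x) \<le> norm x * K"
  shows "bounded_clinear f"
  unfolding bounded_clinear_def
  using assms by (auto intro!: bounded_linear_intro[where K = K] simp: scaleR_scaleC)

lemma bounded_clinear_compose:
  "bounded_clinear f \<Longrightarrow> bounded_clinear g \<Longrightarrow> bounded_clinear (\<lambda>x. f (g x))"
  by (auto simp: bounded_clinear_def intro: bounded_linear_compose)

lemma bounded_cbilinear_left: "bounded_cbilinear m \<Longrightarrow> bounded_clinear (\<lambda>x. m x y)"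
  by (auto simp: bounded_cbilinear_def bounded_clinear_def bounded_bilinear.bounded_linear_left)

lemma bounded_cbilinear_right: "bounded_cbilinear m \<Longrightarrow> bounded_clinear (\<lambda>y. m x y)"
  by (auto simp: bounded_cbilinear_def bounded_clinear_def bounded_bilinear.bounded_linear_right)

lemma bounded_cbilinear_mult:
  "bounded_cbilinear ((*) :: 'a::complex_normed_algebra \<Rightarrow> 'a \<Rightarrow> 'a)"
  by (simp add: bounded_cbilinear_def bounded_bilinear_mult mult_scaleC_left mult_scaleC_right)


section \<open>The dual space\<close>

typedef (overloaded) ('a::complex_normed_vector) dual = "{f :: 'a \<Rightarrow> complex. bounded_clinear f}"
  morphisms dual_apply Dual
  by (rule exI[of _ "\<lambda>x. 0"]) (auto intro!: bounded_clinearI[where K = 0] simp: scaleC_complex_def)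

setup_lifting type_definition_dual

lemma dual_apply_bounded_clinear: "bounded_clinear (dual_apply f)"
  using dual_apply by auto

lemma dual_apply_Dual: "bounded_clinear f \<Longrightarrow> dual_apply (Dual f) x = f x"
  by (simp add: Dual_inverse)

lemma dual_eqI: "(\<And>x. dual_apply f x = dual_apply g x) \<Longrightarrow> f = g"
  by (simp add: dual_apply_inject[symmetric] fun_eq_iff)

instantiation dual :: (complex_normed_vector) complex_normed_vector
begin

lift_definition norm_dual :: "'a dual \<Rightarrow> real" is onorm .

lift_definition zero_dual :: "'a dual" is "\<lambda>x. 0"
  by (auto intro!: bounded_clinearI[where K = 0] simp: scaleC_complex_def)

lift_definition plus_dual :: "'a dual \<Rightarrow> 'a dual \<Rightarrow> 'a dual" is "\<lambda>f g x. f x + g x"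
  by (auto simp: bounded_clinear_def scaleC_add_right bounded_linear_add)

lift_definition minus_dual :: "'a dual \<Rightarrow> 'a dual \<Rightarrow> 'a dual" is "\<lambda>f g x. f x - g x"
  by (auto simp: bounded_clinear_def scaleC_complex_def algebra_simps bounded_linear_sub)

lift_definition uminus_dual :: "'a dual \<Rightarrow> 'a dual" is "\<lambda>f x. - f x"
  by (auto simp: bounded_clinear_def scaleC_complex_def bounded_linear_minus)

lift_definition scaleR_dual :: "real \<Rightarrow> 'a dual \<Rightarrow> 'a dual" is "\<lambda>r f x. r *\<^sub>R f x"
  by (auto simp: bounded_clinear_def scaleC_complex_def scaleR_conv_of_real
      intro: bounded_linear_const_mult)

lift_definition scaleC_dual :: "complex \<Rightarrow> 'a dual \<Rightarrow> 'a dual" is "\<lambda>c f x. c * f x"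
  by (auto simp: bounded_clinear_def scaleC_complex_def intro: bounded_linear_const_mult)

definition dist_dual :: "'a dual \<Rightarrow> 'a dual \<Rightarrow> real"
  where "dist_dual f g = norm (f - g)"

definition [code del]:
  "(uniformity :: ('a dual \<times> 'a dual) filter) = (INF e\<in>{0 <..}. principal {(x, y). dist x y < e})"

definition open_dual :: "'a dual set \<Rightarrow> bool"
  where [code del]: "open_dual S = (\<forall>x\<in>S. \<forall>\<^sub>F (x', y) in uniformity. x' = x \<longrightarrow> y \<in> S)"

definition sgn_dual :: "'a dual \<Rightarrow> 'a dual"
  where "sgn_dual x = scaleR (inverse (norm x)) x"

instance
proof
  fix f g h :: "'a dual" and r s :: real and c d :: complex
  show "r *\<^sub>R f = complex_of_real r *\<^sub>C f"
    by transfer (simp add: scaleR_conv_of_real)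
  show "norm (c *\<^sub>C f) = cmod c * norm f"
  proof transfer
    fix c and f :: "'a \<Rightarrow> complex" assume "bounded_clinear f"
    then have bl: "bounded_linear f" by (simp add: bounded_clinear_def)
    have le: "onorm (\<lambda>x. c * g x) \<le> cmod c * onorm g" if "bounded_linear g"
      for c and g :: "'a \<Rightarrow> complex"
    proof (rule onorm_bound)
      show "0 \<le> cmod c * onorm g" by (simp add: onorm_pos_le that)
      fix x show "cmod (c * g x) \<le> cmod c * onorm g * norm x"
        using mult_left_mono[OF onorm[OF that, of x], of "cmod c"]
        by (simp add: norm_mult mult.assoc)
    qed
    have "cmod c * onorm f \<le> onorm (\<lambda>x. c * f x)"
    proof (cases "c = 0")
      case False
      have "onorm (\<lambda>x. inverse c * (c * f x)) \<le> cmod (inverse c) * onorm (\<lambda>x. c * f x)"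
        by (rule le) (intro bounded_linear_const_mult bl)
      then show ?thesis using False
        by (simp add: mult.assoc[symmetric] norm_inverse norm_divide field_simps)
    qed (simp add: onorm_zero)
    with le[OF bl] show "onorm (\<lambda>x. c * f x) = cmod c * onorm f" by (simp add: antisym)
  qed
  show "norm (f + g) \<le> norm f + norm g"
    by transfer (simp add: bounded_clinear_def onorm_triangle)
  show "norm (r *\<^sub>R f) = \<bar>r\<bar> * norm f"
    by transfer (simp add: bounded_clinear_def onorm_scaleR)
  show "(norm f = 0) = (f = 0)"
    by transfer (auto simp: bounded_clinear_def onorm_eq_0)
  show "dist f g = norm (f - g)" by (rule dist_dual_def)
  show "sgn f = inverse (norm f) *\<^sub>R f" by (rule sgn_dual_def)
qed (simp add: uniformity_dual_def open_dual_def | transfer, force simp: algebra_simps)+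

end

lemma dual_apply_add: "dual_apply f (x + y) = dual_apply f x + dual_apply f y"
  and dual_apply_scaleC: "dual_apply f (c *\<^sub>C x) = c * dual_apply f x"
  and dual_apply_diff: "dual_apply f (x - y) = dual_apply f x - dual_apply f y"
  and dual_apply_0: "dual_apply f 0 = 0"
  using dual_apply_bounded_clinear[of f]
  by (auto simp: bounded_clinear_def scaleC_complex_def linear_add linear_diff linear_0
      dest!: bounded_linear.linear)

lemma dual_plus_apply: "dual_apply (f + g) x = dual_apply f x + dual_apply g x"
  and dual_scaleC_apply: "dual_apply (c *\<^sub>C f) x = c * dual_apply f x"
  and dual_minus_apply: "dual_apply (f - g) x = dual_apply f x - dual_apply g x"
  by (transfer, rule refl)+

lemma norm_dual_apply_le: "cmod (dual_apply f x) \<le> norm f * norm x"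
  by transfer (simp add: bounded_clinear_def onorm)

lemma norm_dual_le:
  "0 \<le> b \<Longrightarrow> (\<And>x. cmod (dual_apply f x) \<le> b * norm x) \<Longrightarrow> norm f \<le> b"
  by transfer (rule onorm_bound)

instance dual :: (complex_normed_vector) banach
proof
  fix X :: "nat \<Rightarrow> 'a dual" assume X: "Cauchy X"
  define Y where "Y n = Blinfun (dual_apply (X n))" for n
  have Y: "blinfun_apply (Y n) = dual_apply (X n)" for n
    using dual_apply_bounded_clinear[of "X n"]
    by (simp add: Y_def bounded_clinear_def bounded_linear_Blinfun_apply)
  have "norm (Y m - Y n) = norm (X m - X n)" for m n
    by (simp add: norm_blinfun.rep_eq norm_dual.rep_eq minus_blinfun.rep_eq minus_dual.rep_eq Y)
  with X have "Cauchy Y" by (simp add: Cauchy_def dist_norm)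
  then obtain L where L: "Y \<longlonglongrightarrow> L" using Cauchy_convergent convergent_def by blast
  then have pw: "(\<lambda>n. dual_apply (X n) x) \<longlonglongrightarrow> blinfun_apply L x" for x
    using blinfun.tendsto[OF L tendsto_const] by (simp add: Y)
  have "blinfun_apply L (c *\<^sub>C x) = c * blinfun_apply L x" for c x
    using LIMSEQ_unique[OF pw[of "c *\<^sub>C x"] tendsto_mult_left[OF pw[of x], of c, folded dual_apply_scaleC]]
    by simp
  then have bL: "bounded_clinear (blinfun_apply L)"
    by (simp add: bounded_clinear_def scaleC_complex_def blinfun.bounded_linear_right)
  have "norm (X n - Dual (blinfun_apply L)) = norm (Y n - L)" for n
    by (simp add: norm_blinfun.rep_eq norm_dual.rep_eq minus_blinfun.rep_eq minus_dual.rep_eq Y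
        dual_apply_Dual[OF bL])
  with L have "X \<longlonglongrightarrow> Dual (blinfun_apply L)"
    by (simp add: tendsto_iff dist_norm)
  then show "convergent X" by (auto simp: convergent_def)
qed

definition adjoint_map ::
  "('a::complex_normed_vector \<Rightarrow> 'b::complex_normed_vector) \<Rightarrow> 'b dual \<Rightarrow> 'a dual"
  where "adjoint_map T f = Dual (\<lambda>x. dual_apply f (T x))"

definition canonical :: "'a::complex_normed_vector \<Rightarrow> 'a dual dual"
  where "canonical x = Dual (\<lambda>f. dual_apply f x)"

definition weak_topology :: "'a::complex_normed_vector topology"
  where "weak_topology = topology_generated_by {{x. dual_apply f x \<in> U} | f U. open U}"

definition weak_star_topology :: "'a::complex_normed_vector dual topology"
  where "weak_star_topology = topology_generated_by {{f. dual_apply f x \<in> U} | x U. open U}"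

lemma adjoint_map_apply:
  "bounded_clinear T \<Longrightarrow> dual_apply (adjoint_map T f) x = dual_apply f (T x)"
  unfolding adjoint_map_def
  by (simp add: dual_apply_Dual bounded_clinear_compose dual_apply_bounded_clinear)

lemma canonical_apply: "dual_apply (canonical x) f = dual_apply f x"
  unfolding canonical_def
proof (rule dual_apply_Dual, rule bounded_clinearI)
  show "cmod (dual_apply f x) \<le> norm f * norm x" for f by (rule norm_dual_apply_le)
qed (simp_all add: dual_plus_apply dual_scaleC_apply scaleC_complex_def)

lemma limitin_weak_star:
  "limitin weak_star_topology h l F \<longleftrightarrow> (\<forall>x. ((\<lambda>i. dual_apply (h i) x) \<longlongrightarrow> dual_apply l x) F)"
proof (intro iffI allI)
  fix x assume l: "limitin weak_star_topology h l F"
  show "((\<lambda>i. dual_apply (h i) x) \<longlongrightarrow> dual_apply l x) F"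
  proof (rule topological_tendstoI)
    fix U assume U: "open U" "dual_apply l x \<in> U"
    then have "openin weak_star_topology {f. dual_apply f x \<in> U}"
      unfolding weak_star_topology_def by (intro topology_generated_by_Basis) auto
    with l U show "\<forall>\<^sub>F i in F. dual_apply (h i) x \<in> U" by (auto simp: limitin_def)
  qed
next
  assume pw: "\<forall>x. ((\<lambda>i. dual_apply (h i) x) \<longlongrightarrow> dual_apply l x) F"
  have "\<forall>\<^sub>F i in F. h i \<in> V"
    if "generate_topology_on {{f. dual_apply f x \<in> U} | x U. open U} V" "l \<in> V" for V
    using that
  proof induction
    case (UN K)
    then obtain k where "k \<in> K" "l \<in> k" by blast
    with UN.IH[of k] show ?case by (auto elim: eventually_mono)
  next
    case (Basis s)
    then obtain x U where s: "s = {f. dual_apply f x \<in> U}" "open U" by blast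
    with pw Basis have "\<forall>\<^sub>F i in F. dual_apply (h i) x \<in> U" by (auto simp: tendsto_def)
    then show ?case by (simp add: s)
  qed (auto simp: eventually_conj_iff)
  moreover have "topspace weak_star_topology = (UNIV :: 'a dual set)"
    unfolding weak_star_topology_def topology_generated_by_topspace by (auto intro: exI[of _ UNIV])
  ultimately show "limitin weak_star_topology h l F"
    by (simp add: limitin_def weak_star_topology_def openin_topology_generated_by_iff)
qed


section \<open>Bimodules and derivations\<close>

text \<open>The multiplication is a parameter because a bidual carries two of them.\<close>

definition banach_bimodule ::
  "('b::{complex_normed_vector,banach} \<Rightarrow> 'b \<Rightarrow> 'b) \<Rightarrow>
   ('b \<Rightarrow> 'y::{complex_normed_vector,banach} \<Rightarrow> 'y) \<Rightarrow> ('y \<Rightarrow> 'b \<Rightarrow> 'y) \<Rightarrow> bool"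
  where "banach_bimodule mul lact ract \<longleftrightarrow> bounded_cbilinear lact \<and> bounded_cbilinear ract \<and>
    (\<forall>a b y. lact (mul a b) y = lact a (lact b y)) \<and>
    (\<forall>a b y. ract y (mul a b) = ract (ract y a) b) \<and>
    (\<forall>a b y. ract (lact a y) b = lact a (ract y b))"

definition derivation ::
  "('b::{complex_normed_vector,banach} \<Rightarrow> 'b \<Rightarrow> 'b) \<Rightarrow>
   ('b \<Rightarrow> 'y::{complex_normed_vector,banach} \<Rightarrow> 'y) \<Rightarrow> ('y \<Rightarrow> 'b \<Rightarrow> 'y) \<Rightarrow> ('b \<Rightarrow> 'y) \<Rightarrow> bool"
  where "derivation mul lact ract D \<longleftrightarrow> bounded_clinear D \<and>
    (\<forall>x y. D (mul x y) = lact x (D y) + ract (D x) y)"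

text \<open>The left action on the dual comes from the right action on the space, and vice versa.\<close>

definition dual_lact ::
  "('y::complex_normed_vector \<Rightarrow> 'b \<Rightarrow> 'y) \<Rightarrow> 'b \<Rightarrow> 'y dual \<Rightarrow> 'y dual"
  where "dual_lact ract b f = Dual (\<lambda>y. dual_apply f (ract y b))"

definition dual_ract ::
  "('b \<Rightarrow> 'y::complex_normed_vector \<Rightarrow> 'y) \<Rightarrow> 'y dual \<Rightarrow> 'b \<Rightarrow> 'y dual"
  where "dual_ract lact f b = Dual (\<lambda>y. dual_apply f (lact b y))"

lemma dual_lact_apply:
  "(\<And>b. bounded_clinear (\<lambda>y. ract y b)) \<Longrightarrow> dual_apply (dual_lact ract b f) y = dual_apply f (ract y b)"
  unfolding dual_lact_def
  by (rule dual_apply_Dual) (rule bounded_clinear_compose[OF dual_apply_bounded_clinear])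

lemma dual_ract_apply:
  "(\<And>b. bounded_clinear (lact b)) \<Longrightarrow> dual_apply (dual_ract lact f b) y = dual_apply f (lact b y)"
  unfolding dual_ract_def
  by (rule dual_apply_Dual) (rule bounded_clinear_compose[OF dual_apply_bounded_clinear])


section \<open>Arens products\<close>

text \<open>\<open>\<langle>b'' \<cdot> a', a\<rangle> = \<langle>b'', a' \<cdot> a\<rangle>\<close> and \<open>\<langle>a'' \<box> b'', a'\<rangle> = \<langle>a'', b'' \<cdot> a'\<rangle>\<close>.\<close>

definition bidual_dual_act :: "'a::complex_normed_algebra dual dual \<Rightarrow> 'a dual \<Rightarrow> 'a dual"
  where "bidual_dual_act b'' a' = Dual (\<lambda>a. dual_apply b'' (dual_ract (*) a' a))"

definition arens_first ::
  "'a::complex_normed_algebra dual dual \<Rightarrow> 'a dual dual \<Rightarrow> 'a dual dual"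
  where "arens_first a'' b'' = Dual (\<lambda>a'. dual_apply a'' (bidual_dual_act b'' a'))"

text \<open>\<open>\<langle>a' \<cdot> a'', a\<rangle> = \<langle>a'', a \<cdot> a'\<rangle>\<close> and \<open>\<langle>a'' \<diamondop> b'', a'\<rangle> = \<langle>b'', a' \<cdot> a''\<rangle>\<close>.\<close>

definition dual_bidual_act :: "'a::complex_normed_algebra dual \<Rightarrow> 'a dual dual \<Rightarrow> 'a dual"
  where "dual_bidual_act a' a'' = Dual (\<lambda>a. dual_apply a'' (dual_lact (*) a a'))"

definition arens_second ::
  "'a::complex_normed_algebra dual dual \<Rightarrow> 'a dual dual \<Rightarrow> 'a dual dual"
  where "arens_second a'' b'' = Dual (\<lambda>a'. dual_apply b'' (dual_bidual_act a' a''))"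

definition arens_regular :: "'a::complex_normed_algebra itself \<Rightarrow> bool"
  where "arens_regular _ \<longleftrightarrow>
    (arens_first :: 'a dual dual \<Rightarrow> 'a dual dual \<Rightarrow> 'a dual dual) = arens_second"


section \<open>Extending a bilinear map to the biduals by iterated limits\<close>

definition iterated_wstar_limit ::
  "('i \<Rightarrow> 'j \<Rightarrow> 'w::complex_normed_vector dual) \<Rightarrow> 'i filter \<Rightarrow> 'j filter \<Rightarrow> 'w dual \<Rightarrow> bool"
  where "iterated_wstar_limit h F G z \<longleftrightarrow>
    (\<exists>y. (\<forall>i. limitin weak_star_topology (h i) (y i) G) \<and> limitin weak_star_topology y z F)"

text \<open>
  Nets are replaced by their eventuality filters on the original space; every proper filter arises
  in this way. The limit does not depend on the filters (lemma \<open>iterated_wstar_limit_ext\<close>), and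
  filters converging to any prescribed pair exist (lemma \<open>wstar_filter_exists\<close>), so the
  description below determines exactly one element.
\<close>

definition bidual_ext ::
  "('u::complex_normed_vector \<Rightarrow> 'v::complex_normed_vector \<Rightarrow> 'w::complex_normed_vector) \<Rightarrow>
   'u dual dual \<Rightarrow> 'v dual dual \<Rightarrow> 'w dual dual"
  where "bidual_ext m u'' v'' = (THE z. \<forall>F G. F \<noteq> bot \<and> G \<noteq> bot \<and>
    limitin weak_star_topology canonical u'' F \<and> limitin weak_star_topology canonical v'' G \<longrightarrow>
    iterated_wstar_limit (\<lambda>u v. canonical (m u v)) F G z)"

lemma functional_interpolation_aux:
  fixes S :: "'a::complex_normed_vector dual set"
  assumes "finite S" "\<And>v. (\<forall>f\<in>S. dual_apply f v = 0) \<Longrightarrow> dual_apply g v = 0"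
    and "\<forall>f\<in>S. dual_apply f v = dual_apply \<phi> f"
  shows "dual_apply g v = dual_apply \<phi> g"
  using assms
proof (induction S arbitrary: g)
  case empty
  then have "g = 0" by (intro dual_eqI) (simp add: zero_dual.rep_eq)
  then show ?case by (simp add: dual_apply_0 zero_dual.rep_eq)
next
  case (insert h S)
  show ?case
  proof (cases "\<forall>v. (\<forall>f\<in>S. dual_apply f v = 0) \<longrightarrow> dual_apply h v = 0")
    case True
    then show ?thesis using insert.prems by (intro insert.IH) auto
  next
    case False
    then obtain w where w: "\<forall>f\<in>S. dual_apply f w = 0" "dual_apply h w \<noteq> 0" by blast
    define c where "c = dual_apply g w / dual_apply h w"
    have "dual_apply (g - c *\<^sub>C h) u = 0" if u: "\<forall>f\<in>S. dual_apply f u = 0" for u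
    proof -
      have "dual_apply g (u - (dual_apply h u / dual_apply h w) *\<^sub>C w) = 0"
        using u w by (intro insert.prems(1)) (auto simp: dual_apply_diff dual_apply_scaleC)
      then show ?thesis
        by (simp add: dual_apply_diff dual_apply_scaleC dual_minus_apply dual_scaleC_apply c_def)
    qed
    then have "dual_apply (g - c *\<^sub>C h) v = dual_apply \<phi> (g - c *\<^sub>C h)"
      using insert.prems by (intro insert.IH) auto
    then show ?thesis using insert.prems(2)
      by (simp add: dual_apply_diff dual_apply_scaleC dual_minus_apply dual_scaleC_apply)
  qed
qed

lemma functional_interpolation:
  fixes S :: "'a::complex_normed_vector dual set"
  assumes "finite S"
  shows "\<exists>v. \<forall>f\<in>S. dual_apply f v = dual_apply \<phi> f"
  using assms
proof (induction S)
  case (insert g S)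
  then obtain v where v: "\<forall>f\<in>S. dual_apply f v = dual_apply \<phi> f" by blast
  show ?case
  proof (cases "\<forall>v. (\<forall>f\<in>S. dual_apply f v = 0) \<longrightarrow> dual_apply g v = 0")
    case True
    with functional_interpolation_aux[OF insert.hyps(1) _ v, of g] v show ?thesis by auto
  next
    case False
    then obtain w where w: "\<forall>f\<in>S. dual_apply f w = 0" "dual_apply g w \<noteq> 0" by blast
    show ?thesis
      by (rule exI[of _ "v + ((dual_apply \<phi> g - dual_apply g v) / dual_apply g w) *\<^sub>C w"])
        (use v w in \<open>auto simp: dual_apply_add dual_apply_scaleC\<close>)
  qed
qed simp

lemma wstar_filter_exists:
  fixes u'' :: "'u::complex_normed_vector dual dual"
  shows "\<exists>F. F \<noteq> bot \<and> limitin weak_star_topology canonical u'' F"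
proof -
  obtain p where p: "\<And>S f. finite S \<Longrightarrow> f \<in> S \<Longrightarrow> dual_apply f (p S) = dual_apply u'' f"
    using functional_interpolation[of _ u''] by metis
  have "((\<lambda>u. dual_apply f u) \<longlongrightarrow> dual_apply u'' f) (filtermap p (finite_subsets_at_top UNIV))" for f
  proof (rule tendsto_eventually)
    have "\<forall>\<^sub>F S in finite_subsets_at_top UNIV. dual_apply f (p S) = dual_apply u'' f"
      unfolding eventually_finite_subsets_at_top by (rule exI[of _ "{f}"]) (auto intro: p)
    then show "\<forall>\<^sub>F u in filtermap p (finite_subsets_at_top UNIV). dual_apply f u = dual_apply u'' f"
      by (simp add: eventually_filtermap)
  qed
  then show ?thesis
    by (intro exI[of _ "filtermap p (finite_subsets_at_top UNIV)"])
      (simp add: limitin_weak_star canonical_apply filtermap_bot_iff)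
qed

lemma bounded_cbilinear_bound:
  assumes "bounded_cbilinear m"
  obtains K where "K \<ge> 0" "\<And>u v. norm (m u v) \<le> norm u * norm v * K"
  using assms bounded_bilinear.nonneg_bounded[of m] unfolding bounded_cbilinear_def by blast

lemma bidual_ext_inner:
  assumes m: "bounded_cbilinear m"
  shows "bounded_clinear (\<lambda>w'. dual_apply v'' (adjoint_map (m u) w'))"
    and "bounded_clinear (\<lambda>u. dual_apply v'' (adjoint_map (m u) w'))"
    and "bounded_clinear
      (\<lambda>w'. dual_apply u'' (Dual (\<lambda>u. dual_apply v'' (adjoint_map (m u) w'))))"
proof -
  obtain K where K: "K \<ge> 0" "\<And>u v. norm (m u v) \<le> norm u * norm v * K"
    using bounded_cbilinear_bound[OF m] by blast
  note app = adjoint_map_apply[OF bounded_cbilinear_right[OF m]]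
  note rules = dual_plus_apply dual_scaleC_apply dual_apply_add dual_apply_scaleC app
    scaleC_complex_def
  have mult: "m (u + u2) v = m u v + m u2 v" "m (c *\<^sub>C u) v = c *\<^sub>C m u v" for u u2 v c
    using m by (auto simp: bounded_cbilinear_def bounded_bilinear.add_left)
  have n1: "norm (adjoint_map (m u) w') \<le> norm w' * norm u * K" for u w'
  proof (rule norm_dual_le)
    show "0 \<le> norm w' * norm u * K" by (simp add: K)
    fix v
    have "cmod (dual_apply w' (m u v)) \<le> norm w' * norm (m u v)" by (rule norm_dual_apply_le)
    also have "\<dots> \<le> norm w' * (norm u * norm v * K)" by (intro mult_left_mono K) simp
    finally show "cmod (dual_apply (adjoint_map (m u) w') v) \<le> norm w' * norm u * K * norm v"
      by (simp add: app mult_ac)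
  qed
  have n2: "cmod (dual_apply v'' (adjoint_map (m u) w')) \<le> norm v'' * (norm w' * norm u * K)" for u w'
    by (rule order_trans[OF norm_dual_apply_le]) (intro mult_left_mono n1, simp)
  have a1: "adjoint_map (m u) (w1 + w2) = adjoint_map (m u) w1 + adjoint_map (m u) w2"
    "adjoint_map (m u) (c *\<^sub>C w1) = c *\<^sub>C adjoint_map (m u) w1"
    "adjoint_map (m (u + u2)) w1 = adjoint_map (m u) w1 + adjoint_map (m u2) w1"
    "adjoint_map (m (c *\<^sub>C u)) w1 = c *\<^sub>C adjoint_map (m u) w1" for u u2 w1 w2 c
    by (rule dual_eqI, simp add: rules mult)+
  show c1: "bounded_clinear (\<lambda>w'. dual_apply v'' (adjoint_map (m u) w'))" for u
    by (rule bounded_clinearI[where K = "norm v'' * norm u * K"])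
      (use n2 in \<open>auto simp: a1 rules mult_ac\<close>)
  show c2: "bounded_clinear (\<lambda>u. dual_apply v'' (adjoint_map (m u) w'))" for w'
    by (rule bounded_clinearI[where K = "norm v'' * norm w' * K"])
      (use n2 in \<open>auto simp: a1 rules mult_ac\<close>)
  let ?g = "\<lambda>w'. Dual (\<lambda>u. dual_apply v'' (adjoint_map (m u) w'))"
  have g: "?g (w1 + w2) = ?g w1 + ?g w2" "?g (c *\<^sub>C w1) = c *\<^sub>C ?g w1" for w1 w2 c
    by (rule dual_eqI, simp only: dual_plus_apply dual_scaleC_apply dual_apply_Dual[OF c2],
        simp only: a1 dual_apply_add dual_apply_scaleC)+
  have ng: "norm (?g w') \<le> norm v'' * norm w' * K" for w'
    by (rule norm_dual_le) (use n2[of _ w'] K in \<open>simp_all add: dual_apply_Dual[OF c2] mult_ac\<close>)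
  show "bounded_clinear (\<lambda>w'. dual_apply u'' (?g w'))"
  proof (rule bounded_clinearI[where K = "norm u'' * norm v'' * K"])
    fix w'
    have "cmod (dual_apply u'' (?g w')) \<le> norm u'' * norm (?g w')" by (rule norm_dual_apply_le)
    also have "\<dots> \<le> norm u'' * (norm v'' * norm w' * K)" by (intro mult_left_mono ng) simp
    finally show "cmod (dual_apply u'' (?g w')) \<le> norm w' * (norm u'' * norm v'' * K)"
      by (simp add: mult_ac)
  qed (simp_all add: g rules)
qed

lemma iterated_wstar_limit_ext:
  assumes m: "bounded_cbilinear m"
    and u: "limitin weak_star_topology canonical u'' F"
    and v: "limitin weak_star_topology canonical v'' G"
  shows "iterated_wstar_limit (\<lambda>u v. canonical (m u v)) F G
    (Dual (\<lambda>w'. dual_apply u'' (Dual (\<lambda>u. dual_apply v'' (adjoint_map (m u) w')))))"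
  unfolding iterated_wstar_limit_def
proof (intro exI conjI allI)
  let ?y = "\<lambda>u. Dual (\<lambda>w'. dual_apply v'' (adjoint_map (m u) w'))"
  note inner = bidual_ext_inner[OF m]
  show "limitin weak_star_topology (\<lambda>v. canonical (m u v)) (?y u) G" for u
    unfolding limitin_weak_star
  proof
    fix w'
    show "((\<lambda>v. dual_apply (canonical (m u v)) w') \<longlongrightarrow> dual_apply (?y u) w') G"
      using v[unfolded limitin_weak_star, rule_format, of "adjoint_map (m u) w'"]
      by (simp add: canonical_apply adjoint_map_apply[OF bounded_cbilinear_right[OF m]]
          dual_apply_Dual[OF inner(1)])
  qed
  show "limitin weak_star_topology ?y
    (Dual (\<lambda>w'. dual_apply u'' (Dual (\<lambda>u. dual_apply v'' (adjoint_map (m u) w'))))) F"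
    unfolding limitin_weak_star
  proof
    fix w'
    show "((\<lambda>u. dual_apply (?y u) w') \<longlongrightarrow> dual_apply
      (Dual (\<lambda>w'. dual_apply u'' (Dual (\<lambda>u. dual_apply v'' (adjoint_map (m u) w'))))) w') F"
      using u[unfolded limitin_weak_star, rule_format, of "Dual (\<lambda>u. dual_apply v'' (adjoint_map (m u) w'))"]
      by (simp add: canonical_apply dual_apply_Dual[OF inner(1)] dual_apply_Dual[OF inner(2)]
          dual_apply_Dual[OF inner(3)])
  qed
qed

lemma wstar_limit_unique:
  assumes "limitin weak_star_topology h l F" "limitin weak_star_topology h l2 F" "F \<noteq> bot"
  shows "l = l2"
  using assms by (intro dual_eqI) (auto simp: limitin_weak_star intro: tendsto_unique)

lemma iterated_wstar_limit_unique:
  assumes "iterated_wstar_limit h F G z" "iterated_wstar_limit h F G z2" "F \<noteq> bot" "G \<noteq> bot"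
  shows "z = z2"
proof -
  obtain y y2 where y: "\<And>i. limitin weak_star_topology (h i) (y i) G" "limitin weak_star_topology y z F"
    and y2: "\<And>i. limitin weak_star_topology (h i) (y2 i) G" "limitin weak_star_topology y2 z2 F"
    using assms unfolding iterated_wstar_limit_def by blast
  have "y = y2" using wstar_limit_unique[OF y(1) y2(1)] assms by blast
  with y y2 assms show ?thesis by (auto intro: wstar_limit_unique)
qed

lemma bidual_ext_eq:
  assumes m: "bounded_cbilinear m"
  shows "bidual_ext m u'' v'' =
    Dual (\<lambda>w'. dual_apply u'' (Dual (\<lambda>u. dual_apply v'' (adjoint_map (m u) w'))))"
proof -
  obtain F G where FG: "F \<noteq> bot" "limitin weak_star_topology canonical u'' F"
    "G \<noteq> bot" "limitin weak_star_topology canonical v'' G"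
    using wstar_filter_exists by meson
  show ?thesis
    unfolding bidual_ext_def
  proof (rule the_equality)
    fix z assume "\<forall>F G. F \<noteq> bot \<and> G \<noteq> bot \<and>
      limitin weak_star_topology canonical u'' F \<and> limitin weak_star_topology canonical v'' G \<longrightarrow>
      iterated_wstar_limit (\<lambda>u v. canonical (m u v)) F G z"
    then have "iterated_wstar_limit (\<lambda>u v. canonical (m u v)) F G z" using FG by blast
    then show "z = Dual (\<lambda>w'. dual_apply u'' (Dual (\<lambda>u. dual_apply v'' (adjoint_map (m u) w'))))"
      using iterated_wstar_limit_ext[OF m FG(2) FG(4)] FG by (rule_tac iterated_wstar_limit_unique)
  qed (auto intro: iterated_wstar_limit_ext[OF m])
qed

lemma bidual_ext_apply:
  assumes m: "bounded_cbilinear m"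
  shows "dual_apply (bidual_ext m u'' v'') w' =
    dual_apply u'' (Dual (\<lambda>u. dual_apply v'' (adjoint_map (m u) w')))"
  unfolding bidual_ext_eq[OF m] by (rule dual_apply_Dual) (rule bidual_ext_inner(3)[OF m])

lemma arens_first_eq_bidual_ext: "arens_first = bidual_ext (*)"
  by (intro ext) (simp add: arens_first_def bidual_dual_act_def dual_ract_def adjoint_map_def
      bidual_ext_eq[OF bounded_cbilinear_mult])

end

theory Submission
  imports Defs
begin

text \<open>
  Write \<open>D''\<close> for the second adjoint of \<open>D\<close>. Expanding \<open>D (a b) = a \<cdot> D b + D a \<cdot> b\<close> inside the
  iterated limit that defines the first Arens product shows that one half of the derivation rule always passes to
  the biduals: the limit of \<open>D a \<cdot> b\<close> is \<open>D'' a'' \<cdot> b''\<close>. What remains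
  (\<open>biadjoint_derivation_product\<close>) is the requirement, for all \<open>a''\<close>, \<open>b''\<close> and \<open>x''\<close>,
  that \<open>\<langle>D'' b'', x'' a''\<rangle>\<close> be the value at \<open>a''\<close> of the functional
  \<open>a \<mapsto> \<langle>D'' b'', x'' a\<rangle>\<close> on \<open>A\<close>.

  On the other hand, a linear map \<open>L\<close> out of a bidual is weak-star-to-weak continuous exactly if, for
  every functional \<open>g\<close>, the composite \<open>g \<circ> L\<close> is evaluation at its own restriction to the
  original space (\<open>continuous_map_weak_star_weak_iff\<close>). So the derivation rule states this
  continuity of \<open>a'' \<mapsto> x'' a''\<close> as tested by the functionals in the range of \<open>D''\<close> only, and the
  theorem follows once \<open>D''\<close> is known to be surjective (\<open>surj_biadjoint\<close>).

  Surjectivity passes from \<open>D\<close> to \<open>D''\<close> in two steps. By uniform boundedness the adjoint of a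
  surjection onto a Banach space is bounded below; by the Hahn--Banach theorem the adjoint
  of a map that is bounded below is surjective.
\<close>

section \<open>Sublinear functionals and the Hahn--Banach theorem\<close>

definition sublinear :: "('v::real_vector \<Rightarrow> real) \<Rightarrow> bool"
  where "sublinear q \<longleftrightarrow>
    (\<forall>x y. q (x + y) \<le> q x + q y) \<and> (\<forall>c>0. \<forall>x. q (c *\<^sub>R x) \<le> c * q x)"

lemma sublinear_add: "sublinear q \<Longrightarrow> q (x + y) \<le> q x + q y"
  and sublinear_scale_le: "sublinear q \<Longrightarrow> c > 0 \<Longrightarrow> q (c *\<^sub>R x) \<le> c * q x"
  by (auto simp: sublinear_def)

lemma sublinear_scale:
  assumes "sublinear q" "c > 0"
  shows "q (c *\<^sub>R x) = c * q x"
proof (rule antisym)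
  have "q (inverse c *\<^sub>R c *\<^sub>R x) \<le> inverse c * q (c *\<^sub>R x)"
    using assms by (intro sublinear_scale_le) auto
  then show "c * q x \<le> q (c *\<^sub>R x)"
    using assms(2) by (simp add: field_simps)
qed (use assms in \<open>rule sublinear_scale_le\<close>)

lemma sublinear_zero: "sublinear q \<Longrightarrow> q 0 = 0"
  using sublinear_scale[of q 2 0] by simp

lemma sublinear_ge: "sublinear q \<Longrightarrow> - q (- x) \<le> q x"
  using sublinear_add[of q x "- x"] sublinear_zero[of q] by simp

text \<open>
  Every infimum of functionals below is an instance: the infimum of a chain, the lowering
  of a functional in one direction, and the functional that encodes an extension problem. In the
  last two the members \<open>g i\<close> are not sublinear themselves, only the family as a whole is, so the
  conditions let the index change.
\<close>

lemma sublinear_INF: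
  fixes g :: "'i \<Rightarrow> 'v::real_vector \<Rightarrow> real"
  assumes "I \<noteq> {}"
    and bdd: "\<And>x. bdd_below ((\<lambda>i. g i x) ` I)"
    and add: "\<And>i j x y. i \<in> I \<Longrightarrow> j \<in> I \<Longrightarrow> \<exists>k\<in>I. g k (x + y) \<le> g i x + g j y"
    and scale: "\<And>i c x. i \<in> I \<Longrightarrow> c > 0 \<Longrightarrow> \<exists>k\<in>I. g k (c *\<^sub>R x) \<le> c * g i x"
  shows "sublinear (\<lambda>x. INF i\<in>I. g i x)"
  unfolding sublinear_def
proof (intro conjI allI impI)
  let ?q = "\<lambda>x. INF i\<in>I. g i x"
  have le: "?q x \<le> g k x" if "k \<in> I" for k x
    using that bdd by (rule cINF_lower[rotated])
  fix x y
  have "?q (x + y) - g j y \<le> ?q x" if j: "j \<in> I" for j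
  proof (rule cINF_greatest[OF \<open>I \<noteq> {}\<close>])
    fix i assume "i \<in> I"
    with add j obtain k where "k \<in> I" "g k (x + y) \<le> g i x + g j y" by blast
    with le[of k "x + y"] show "?q (x + y) - g j y \<le> g i x" by linarith
  qed
  then have "?q (x + y) - ?q x \<le> ?q y"
    by (intro cINF_greatest[OF \<open>I \<noteq> {}\<close>]) (simp add: algebra_simps)
  then show "?q (x + y) \<le> ?q x + ?q y" by linarith
next
  let ?q = "\<lambda>x. INF i\<in>I. g i x"
  fix c :: real and x assume c: "c > 0"
  have "?q (c *\<^sub>R x) / c \<le> ?q x"
  proof (rule cINF_greatest[OF \<open>I \<noteq> {}\<close>])
    fix i assume "i \<in> I"
    with scale c obtain k where k: "k \<in> I" "g k (c *\<^sub>R x) \<le> c * g i x" by blast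
    then have "?q (c *\<^sub>R x) \<le> c * g i x"
      using cINF_lower[OF bdd[of "c *\<^sub>R x"] k(1)] by linarith
    with c show "?q (c *\<^sub>R x) / c \<le> g i x" by (simp add: field_simps)
  qed
  with c show "?q (c *\<^sub>R x) \<le> c * ?q x" by (simp add: field_simps)
qed

text \<open>
  For \<open>x\<close> fixed, lower \<open>q\<close> to \<open>r y = inf {q (y + t x) - t q x | t \<ge> 0}\<close>. By minimality \<open>r = q\<close>, and
  the competitor \<open>t = 1\<close> then gives \<open>q y + q x \<le> q (y + x)\<close>, the inequality that subadditivity lacks.
\<close>

lemma minimal_sublinear_linear:
  assumes q: "sublinear q"
    and min: "\<And>r. sublinear r \<Longrightarrow> (\<And>x. r x \<le> q x) \<Longrightarrow> r = q"
  shows "linear q"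
proof -
  have additive: "q (x + y) = q x + q y" for x y
  proof -
    define g where "g t y = q (y + t *\<^sub>R x) - t * q x" for t y
    define r where "r = (\<lambda>y. INF t\<in>{0..}. g t y)"
    have hom: "q (t *\<^sub>R x) = t * q x" if "t \<ge> 0" for t
      using that sublinear_scale[OF q] sublinear_zero[OF q] by (cases "t = 0") auto
    have bdd: "bdd_below ((\<lambda>t. g t y) ` {0..})" for y
    proof (rule bdd_belowI2)
      fix t :: real assume "t \<in> {0..}"
      then show "- q (- y) \<le> g t y"
        using sublinear_add[OF q, of "y + t *\<^sub>R x" "- y"] hom[of t] by (simp add: g_def)
    qed
    have "sublinear r"
      unfolding r_def
    proof (rule sublinear_INF)
      fix s t :: real and y z assume st: "s \<in> {0..}" "t \<in> {0..}"
      have "g (s + t) (y + z) \<le> g s y + g t z"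
        using sublinear_add[OF q, of "y + s *\<^sub>R x" "z + t *\<^sub>R x"]
        by (simp add: g_def algebra_simps)
      with st show "\<exists>k\<in>{0..}. g k (y + z) \<le> g s y + g t z"
        by (intro bexI[of _ "s + t"]) auto
    next
      fix t c :: real and y assume t: "t \<in> {0..}" and c: "c > 0"
      have "g (c * t) (c *\<^sub>R y) \<le> c * g t y"
        using sublinear_scale_le[OF q c, of "y + t *\<^sub>R x"] by (simp add: g_def algebra_simps)
      with t c show "\<exists>k\<in>{0..}. g k (c *\<^sub>R y) \<le> c * g t y"
        by (intro bexI[of _ "c * t"]) auto
    qed (use bdd in auto)
    moreover have "r z \<le> g t z" if "t \<ge> 0" for t z
      unfolding r_def using that by (intro cINF_lower bdd) auto
    from this[of 0] this[of 1] have "r z \<le> q z" "r z \<le> q (z + x) - q x" for z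
      by (simp_all add: g_def)
    ultimately have "q y \<le> q (y + x) - q x" using min by metis
    with sublinear_add[OF q, of x y] show ?thesis by (simp add: add.commute)
  qed
  have neg: "q (- x) = - q x" for x
    using additive[of x "- x"] sublinear_zero[OF q] by simp
  have "q (c *\<^sub>R x) = c * q x" for c x
  proof (cases c "0 :: real" rule: linorder_cases)
    case less
    then show ?thesis using sublinear_scale[OF q, of "- c" x] neg[of "c *\<^sub>R x"] by simp
  qed (use sublinear_scale[OF q] sublinear_zero[OF q] in auto)
  with additive show ?thesis by (intro linearI) simp_all
qed

text \<open>
  The Hahn--Banach theorem without a subspace: Zorn's lemma gives a minimal sublinear functional
  below \<open>p\<close>. An extension problem is encoded in the choice of \<open>p\<close>.
\<close>

theorem sublinear_dominates_linear:
  assumes p: "sublinear p"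
  obtains q where "linear q" "\<And>x. q x \<le> p x"
proof -
  let ?A = "{q. sublinear q \<and> q \<le> p}"
  have "\<exists>q\<in>?A. \<forall>r\<in>?A. r \<le> q \<longrightarrow> r = q"
  proof (rule predicate_Zorn)
    show "partial_order_on ?A (relation_of (\<lambda>q r. r \<le> q) ?A)"
      by (rule partial_order_on_relation_ofI) auto
    fix C assume C: "C \<in> Chains (relation_of (\<lambda>q r. r \<le> q) ?A)"
    then have CA: "C \<subseteq> ?A" by (rule Chains_relation_of)
    have chain: "q \<le> r \<or> r \<le> q" if "q \<in> C" "r \<in> C" for q r
      using C that by (auto simp: Chains_def relation_of_def)
    show "\<exists>u\<in>?A. \<forall>q\<in>C. u \<le> q"
    proof (cases "C = {}")
      case True
      with p show ?thesis by auto
    next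
      case False
      let ?u = "\<lambda>x. INF q\<in>C. q x"
      have bdd: "bdd_below ((\<lambda>q. q x) ` C)" for x
      proof (rule bdd_belowI2)
        fix q assume "q \<in> C"
        with CA have "sublinear q" "q (- x) \<le> p (- x)" by (auto simp: le_fun_def)
        with sublinear_ge[of q x] show "- p (- x) \<le> q x" by linarith
      qed
      have le: "?u x \<le> q x" if "q \<in> C" for q x
        using that by (intro cINF_lower bdd)
      have "sublinear ?u"
      proof (rule sublinear_INF[OF False bdd])
        fix q r x y assume qr: "q \<in> C" "r \<in> C"
        with chain obtain k where k: "k \<in> C" "k \<le> q" "k \<le> r" by blast
        with CA have "k (x + y) \<le> k x + k y" by (auto intro: sublinear_add)
        also have "\<dots> \<le> q x + r y" using k by (intro add_mono) (auto simp: le_fun_def)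
        finally show "\<exists>k\<in>C. k (x + y) \<le> q x + r y" using k by blast
      qed (use CA in \<open>auto intro: sublinear_scale_le\<close>)
      moreover have "?u \<le> p"
      proof (rule le_funI)
        fix x
        obtain q where q: "q \<in> C" using False by blast
        have "?u x \<le> q x" using q by (rule le)
        also have "\<dots> \<le> p x" using q CA by (auto simp: le_fun_def)
        finally show "?u x \<le> p x" .
      qed
      ultimately show ?thesis using le by (intro bexI[of _ ?u]) (auto simp: le_fun_def)
    qed
  qed
  then obtain q where q: "sublinear q" "q \<le> p" and min: "\<And>r. r \<in> ?A \<Longrightarrow> r \<le> q \<Longrightarrow> r = q"
    by blast
  have "linear q"
  proof (rule minimal_sublinear_linear[OF q(1)])
    fix r assume r: "sublinear r" "\<And>x. r x \<le> q x"
    then have "r \<le> q" by (simp add: le_fun_def)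
    with r q(2) show "r = q" by (intro min) auto
  qed
  with q(2) show thesis by (intro that) (auto simp: le_fun_def)
qed


section \<open>Surjectivity of the second adjoint\<close>

lemma bounded_clinear_adjoint:
  assumes T: "bounded_clinear T"
  shows "bounded_clinear (adjoint_map T)"
proof (rule bounded_clinearI[where K = "onorm T"])
  have bl: "bounded_linear T" using T by (simp add: bounded_clinear_def)
  show "norm (adjoint_map T f) \<le> norm f * onorm T" for f
  proof (rule norm_dual_le)
    fix x
    have "cmod (dual_apply f (T x)) \<le> norm f * norm (T x)" by (rule norm_dual_apply_le)
    also have "\<dots> \<le> norm f * (onorm T * norm x)"
      by (intro mult_left_mono onorm bl) simp
    finally show "cmod (dual_apply (adjoint_map T f) x) \<le> norm f * onorm T * norm x"
      by (simp add: adjoint_map_apply[OF T] mult.assoc)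
  qed (simp add: onorm_pos_le bl)
qed (rule dual_eqI, simp add: adjoint_map_apply[OF T] dual_plus_apply dual_scaleC_apply)+

lemma bounded_clinear_canonical: "bounded_clinear canonical"
proof (rule bounded_clinearI[where K = 1])
  show "norm (canonical x) \<le> norm x * 1" for x :: 'a
    by (rule norm_dual_le) (simp_all add: canonical_apply mult.commute[of "norm x"] norm_dual_apply_le)
qed (rule dual_eqI, simp add: canonical_apply dual_plus_apply dual_scaleC_apply dual_apply_add
    dual_apply_scaleC)+

text \<open>
  A complex functional is determined by its real part \<open>q\<close> as \<open>q x - \<i> q (\<i> x)\<close>; this reduces the
  complex extension problem to the real one.
\<close>

lemma complexify_bounded_clinear:
  fixes q :: "'v::complex_normed_vector \<Rightarrow> real"
  assumes q: "linear q" and le: "\<And>x. q x \<le> K * norm x"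
  shows "bounded_clinear (\<lambda>x. Complex (q x) (- q (\<i> *\<^sub>C x)))"
proof (rule bounded_clinearI[where K = "2 * K"])
  fix x y :: 'v and c :: complex
  have I: "\<i> *\<^sub>C \<i> *\<^sub>C x = - x"
    using scaleR_scaleC[of "-1" x] by (simp add: scaleC_scaleC)
  show "Complex (q (x + y)) (- q (\<i> *\<^sub>C (x + y))) =
      Complex (q x) (- q (\<i> *\<^sub>C x)) + Complex (q y) (- q (\<i> *\<^sub>C y))"
    by (simp add: scaleC_add_right linear_add[OF q] complex_eq_iff)
  have c: "c *\<^sub>C z = Re c *\<^sub>R z + Im c *\<^sub>R \<i> *\<^sub>C z" for z :: 'v
    by (subst complex_eq[of c])
      (simp add: scaleC_add_left scaleR_scaleC scaleC_scaleC mult.commute)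
  have ic: "\<i> *\<^sub>C c *\<^sub>C x = c *\<^sub>C \<i> *\<^sub>C x" by (simp add: scaleC_scaleC mult.commute)
  show "Complex (q (c *\<^sub>C x)) (- q (\<i> *\<^sub>C c *\<^sub>C x)) = c *\<^sub>C Complex (q x) (- q (\<i> *\<^sub>C x))"
    unfolding ic unfolding c[of x] c[of "\<i> *\<^sub>C x"] I
    by (simp add: complex_eq_iff scaleC_complex_def linear_add[OF q] linear_scale[OF q]
        linear_neg[OF q] linear_diff[OF q])
  have abs: "\<bar>q z\<bar> \<le> K * norm z" for z
    using le[of z] le[of "- z"] by (simp add: linear_neg[OF q])
  have "cmod (Complex (q x) (- q (\<i> *\<^sub>C x))) \<le> \<bar>q x\<bar> + \<bar>q (\<i> *\<^sub>C x)\<bar>"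
    using cmod_le[of "Complex (q x) (- q (\<i> *\<^sub>C x))"] by simp
  also have "\<dots> \<le> norm x * (2 * K)"
    using abs[of x] abs[of "\<i> *\<^sub>C x"] by (simp add: norm_scaleC algebra_simps)
  finally show "norm (Complex (q x) (- q (\<i> *\<^sub>C x))) \<le> norm x * (2 * K)" .
qed

text \<open>
  A preimage of \<open>f\<close> has to be an extension of the functional \<open>T v \<mapsto> f v\<close> from the range of \<open>T\<close>.
  The sublinear functional \<open>p w = inf\<^sub>v (Re (f v) + K \<parallel>w - T v\<parallel>)\<close> forces this: a linear functional
  below \<open>p\<close> is at most \<open>Re (f v)\<close> at \<open>T v\<close>, hence equal to it by the symmetry \<open>v \<mapsto> - v\<close>, and at
  most \<open>K \<parallel>w\<parallel>\<close> at \<open>w\<close>. That \<open>T\<close> is bounded below makes the infimum finite.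
\<close>

lemma surj_adjoint_of_bounded_below:
  fixes T :: "'v::complex_normed_vector \<Rightarrow> 'w::complex_normed_vector"
  assumes T: "bounded_clinear T"
    and "C \<ge> 0" and below: "\<And>v. norm v \<le> C * norm (T v)"
  shows "surj (adjoint_map T)"
  unfolding surj_def
proof
  fix f :: "'v dual"
  have Tl: "linear T" using T by (auto simp: bounded_clinear_def dest: bounded_linear.linear)
  \<comment> \<open>On the range of \<open>T\<close> the functional \<open>T v \<mapsto> f v\<close> has norm at most this \<open>K\<close>.\<close>
  define K where "K = norm f * C"
  have "K \<ge> 0" using \<open>C \<ge> 0\<close> by (simp add: K_def)
  define g where "g v w = Re (dual_apply f v) + K * norm (w - T v)" for v w
  define p where "p = (\<lambda>w. INF v. g v w)"
  have lower: "- K * norm w \<le> g v w" for v w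
  proof -
    have "- Re (dual_apply f v) \<le> cmod (dual_apply f v)"
      using abs_Re_le_cmod[of "dual_apply f v"] by linarith
    also have "\<dots> \<le> norm f * norm v" by (rule norm_dual_apply_le)
    also have "\<dots> \<le> norm f * (C * norm (T v))" by (intro mult_left_mono below) simp
    also have "\<dots> \<le> K * (norm w + norm (w - T v))"
      unfolding K_def mult.assoc[symmetric] using \<open>C \<ge> 0\<close> norm_triangle_sub[of "T v" w]
      by (intro mult_left_mono) (auto simp: norm_minus_commute)
    finally show ?thesis by (simp add: g_def algebra_simps)
  qed
  then have bdd: "bdd_below (range (\<lambda>v. g v w))" for w by (intro bdd_belowI2)
  have p_le: "p w \<le> g v w" for v w unfolding p_def by (intro cINF_lower bdd) simp
  have "sublinear p"
    unfolding p_def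
  proof (rule sublinear_INF)
    fix u v x y
    have "norm (x + y - T (u + v)) \<le> norm (x - T u) + norm (y - T v)"
      using norm_triangle_ineq[of "x - T u" "y - T v"]
      by (simp add: linear_add[OF Tl] algebra_simps)
    then have "g (u + v) (x + y) \<le> g u x + g v y"
      using mult_left_mono[OF _ \<open>K \<ge> 0\<close>] by (fastforce simp: g_def dual_apply_add algebra_simps)
    then show "\<exists>k\<in>UNIV. g k (x + y) \<le> g u x + g v y" by blast
  next
    fix v c x assume c: "(c::real) > 0"
    have "norm (c *\<^sub>R x - T (c *\<^sub>R v)) = c * norm (x - T v)"
      using c by (simp add: linear_scale[OF Tl] flip: scaleR_diff_right)
    moreover have "dual_apply f (c *\<^sub>R v) = c *\<^sub>R dual_apply f v"
      by (simp add: scaleR_scaleC dual_apply_scaleC scaleC_complex_def)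
    ultimately have "g (c *\<^sub>R v) (c *\<^sub>R x) \<le> c * g v x"
      by (simp add: g_def algebra_simps)
    then show "\<exists>k\<in>UNIV. g k (c *\<^sub>R x) \<le> c * g v x" by blast
  qed (use bdd in auto)
  then obtain q where q: "linear q" and qp: "\<And>w. q w \<le> p w"
    by (rule sublinear_dominates_linear) blast
  have "q w \<le> K * norm w" for w
    using qp[of w] p_le[of w 0] by (simp add: g_def dual_apply_0 linear_0[OF Tl])
  then have cl: "bounded_clinear (\<lambda>w. Complex (q w) (- q (\<i> *\<^sub>C w)))"
    by (rule complexify_bounded_clinear[OF q])
  have qT_le: "q (T v) \<le> Re (dual_apply f v)" for v
    using qp[of "T v"] p_le[of "T v" v] by (simp add: g_def)
  have qT: "q (T v) = Re (dual_apply f v)" for v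
  proof -
    have "dual_apply f (- v) = - dual_apply f v"
      using dual_apply_diff[of f 0 v] by (simp add: dual_apply_0)
    then show ?thesis
      using qT_le[of v] qT_le[of "- v"] by (simp add: linear_neg[OF Tl] linear_neg[OF q])
  qed
  have "\<i> *\<^sub>C T v = T (\<i> *\<^sub>C v)" for v using T by (simp add: bounded_clinear_def)
  then have "adjoint_map T (Dual (\<lambda>w. Complex (q w) (- q (\<i> *\<^sub>C w)))) = f"
    by (intro dual_eqI)
      (simp add: adjoint_map_apply[OF T] dual_apply_Dual[OF cl] qT dual_apply_scaleC complex_eq_iff)
  then show "\<exists>h. f = adjoint_map T h" by metis
qed

text \<open>
  By Baire's theorem one of the closed sets on which all functionals are bounded by \<open>n\<close>
  contains a ball; differences of its points control the functionals on a ball around the origin.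
\<close>

theorem uniform_boundedness:
  fixes S :: "'v::{complex_normed_vector,banach} dual set"
  assumes pw: "\<And>v. \<exists>M. \<forall>f\<in>S. cmod (dual_apply f v) \<le> M"
  obtains C where "C \<ge> 0" "\<And>f. f \<in> S \<Longrightarrow> norm f \<le> C"
proof -
  define A where "A n = {v. \<forall>f\<in>S. cmod (dual_apply f v) \<le> real n}" for n :: nat
  have "continuous_on UNIV (dual_apply f)" for f :: "'v dual"
    using dual_apply_bounded_clinear[of f]
    by (simp add: bounded_clinear_def linear_continuous_on)
  then have "closed {v. cmod (dual_apply f v) \<le> real n}" for f :: "'v dual" and n
    by (intro closed_Collect_le continuous_intros)
  then have closed: "closed (A n)" for n
    unfolding A_def Collect_ball_eq by (intro closed_INT) simp
  have "v \<in> (\<Union>n. A n)" for v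
  proof -
    obtain M where M: "\<forall>f\<in>S. cmod (dual_apply f v) \<le> M" using pw by blast
    obtain n :: nat where "M \<le> real n" using real_arch_simple by blast
    with M have "v \<in> A n" unfolding A_def by (blast intro: order_trans)
    then show ?thesis by blast
  qed
  then have "(\<Union>n. A n) = UNIV" by blast
  moreover have "euclidean interior_of (\<Union>n. A n) = {}" if "\<And>n. interior (A n) = {}"
  proof (rule Baire_category_alt)
    show "closedin euclidean B \<and> euclidean interior_of B = {}" if "B \<in> range A" for B
      using that closed \<open>\<And>n. interior (A n) = {}\<close> by auto
  qed (simp_all add: completely_metrizable_space_euclidean)
  ultimately obtain n where "interior (A n) \<noteq> {}" by auto
  then obtain v0 e where e: "e > 0" "cball v0 e \<subseteq> A n"
    using mem_interior_cball by blast
  show thesis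
  proof (rule that)
    show "0 \<le> 2 * real n / e" using e by simp
    fix f assume f: "f \<in> S"
    show "norm f \<le> 2 * real n / e"
    proof (rule norm_dual_le)
      fix v
      show "cmod (dual_apply f v) \<le> 2 * real n / e * norm v"
      proof (cases "v = 0")
        case False
        define w where "w = (e / norm v) *\<^sub>R v"
        have "norm w = e" using False e by (simp add: w_def)
        then have "v0 + w \<in> A n" "v0 \<in> A n" using e by (auto simp: dist_norm)
        then have "cmod (dual_apply f (v0 + w)) \<le> n" "cmod (dual_apply f v0) \<le> n"
          using f by (auto simp: A_def)
        then have "cmod (dual_apply f w) \<le> 2 * n"
          using norm_triangle_ineq4[of "dual_apply f (v0 + w)" "dual_apply f v0"]
          by (simp add: dual_apply_add)
        moreover have "dual_apply f w = complex_of_real (e / norm v) * dual_apply f v"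
          by (simp add: w_def scaleR_scaleC dual_apply_scaleC)
        ultimately show ?thesis using False e by (simp add: norm_mult norm_divide field_simps)
      qed (simp add: dual_apply_0)
    qed (use e in simp)
  qed
qed

text \<open>
  If \<open>T\<close> is onto, the functionals \<open>f\<close> with \<open>\<parallel>T' f\<parallel> \<le> 1\<close> are pointwise bounded, since
  \<open>\<langle>f, T v\<rangle> = \<langle>T' f, v\<rangle>\<close>. Uniform boundedness then says that \<open>T'\<close> is bounded below, which replaces
  the open mapping theorem here.
\<close>

theorem surj_biadjoint:
  fixes T :: "'v::complex_normed_vector \<Rightarrow> 'w::{complex_normed_vector,banach}"
  assumes T: "bounded_clinear T" and "surj T"
  shows "surj (adjoint_map (adjoint_map T))"
proof -
  let ?S = "{f. norm (adjoint_map T f) \<le> 1}"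
  have "\<exists>M. \<forall>f\<in>?S. cmod (dual_apply f w) \<le> M" for w
  proof -
    obtain v where v: "w = T v" using \<open>surj T\<close> by blast
    have "cmod (dual_apply f w) \<le> norm v" if "f \<in> ?S" for f
    proof -
      have "cmod (dual_apply (adjoint_map T f) v) \<le> norm (adjoint_map T f) * norm v"
        by (rule norm_dual_apply_le)
      also have "\<dots> \<le> 1 * norm v" using that by (intro mult_right_mono) auto
      finally show ?thesis by (simp add: v adjoint_map_apply[OF T])
    qed
    then show ?thesis by blast
  qed
  then obtain C where C: "C \<ge> 0" "\<And>f. f \<in> ?S \<Longrightarrow> norm f \<le> C"
    using uniform_boundedness by blast
  have T': "bounded_clinear (adjoint_map T)" by (rule bounded_clinear_adjoint[OF T])
  have scale: "adjoint_map T (r *\<^sub>R f) = r *\<^sub>R adjoint_map T f" for r f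
    using T' by (simp add: bounded_clinear_def linear_simps)
  have "norm f \<le> C * norm (adjoint_map T f)" for f
  proof (cases "adjoint_map T f = 0")
    case True
    have "f = 0"
    proof (rule dual_eqI)
      fix w
      obtain v where "w = T v" using \<open>surj T\<close> by blast
      then show "dual_apply f w = dual_apply 0 w"
        using True by (simp add: zero_dual.rep_eq flip: adjoint_map_apply[OF T])
    qed
    then show ?thesis using C by simp
  next
    case False
    have "norm (inverse (norm (adjoint_map T f)) *\<^sub>R f) \<le> C"
      using False by (intro C) (simp add: scale)
    with False show ?thesis by (simp add: field_simps)
  qed
  with C(1) T' show ?thesis by (intro surj_adjoint_of_bounded_below)
qed


section \<open>Continuity from the weak-star to the weak topology\<close>

text \<open>
  Each element of the bidual is a weak-star limit of elements of the space, so continuity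
  determines \<open>g \<circ> L\<close> from its restriction to the space; conversely an evaluation is weak-star
  continuous by definition.
\<close>

lemma continuous_map_weak_star_weak_iff:
  fixes L :: "'v::complex_normed_vector dual dual \<Rightarrow> 'w::complex_normed_vector"
  assumes L: "bounded_clinear L"
  shows "continuous_map weak_star_topology weak_topology L \<longleftrightarrow>
    (\<forall>g v''. dual_apply g (L v'') = dual_apply v'' (Dual (\<lambda>v. dual_apply g (L (canonical v)))))"
proof
  have cl: "bounded_clinear (\<lambda>v. dual_apply g (L (canonical v)))" for g
    by (rule bounded_clinear_compose[OF dual_apply_bounded_clinear
          bounded_clinear_compose[OF L bounded_clinear_canonical]])
  have top: "topspace weak_topology = (UNIV :: 'w set)"
    unfolding weak_topology_def topology_generated_by_topspace by (auto intro: exI[of _ UNIV])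
  {
    assume cont: "continuous_map weak_star_topology weak_topology L"
    show "\<forall>g v''. dual_apply g (L v'') = dual_apply v'' (Dual (\<lambda>v. dual_apply g (L (canonical v))))"
    proof (intro allI)
      fix g :: "'w dual" and v'' :: "'v dual dual"
      obtain F where F: "F \<noteq> bot" "limitin weak_star_topology canonical v'' F"
        using wstar_filter_exists by blast
      have "openin weak_topology {y. dual_apply g y \<in> U}" if "open U" for U
        unfolding weak_topology_def using that by (intro topology_generated_by_Basis) auto
      then have "continuous_map weak_topology euclidean (dual_apply g)"
        by (simp add: continuous_map_def top)
      then have "continuous_map weak_star_topology euclidean (dual_apply g \<circ> L)"
        by (rule continuous_map_compose[OF cont])
      from continuous_map_limit[OF this F(2)]
      have "((\<lambda>v. dual_apply g (L (canonical v))) \<longlongrightarrow> dual_apply g (L v'')) F"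
        by (simp add: o_def)
      moreover have "((\<lambda>v. dual_apply g (L (canonical v))) \<longlongrightarrow>
          dual_apply v'' (Dual (\<lambda>v. dual_apply g (L (canonical v))))) F"
        using F(2)[unfolded limitin_weak_star, rule_format, of "Dual (\<lambda>v. dual_apply g (L (canonical v)))"]
        by (simp add: canonical_apply dual_apply_Dual[OF cl])
      ultimately show "dual_apply g (L v'') = dual_apply v'' (Dual (\<lambda>v. dual_apply g (L (canonical v))))"
        using F(1) by (rule tendsto_unique[rotated])
    qed
  }
  assume eq: "\<forall>g v''. dual_apply g (L v'') = dual_apply v'' (Dual (\<lambda>v. dual_apply g (L (canonical v))))"
  have top': "topspace weak_star_topology = (UNIV :: 'v dual dual set)"
    unfolding weak_star_topology_def topology_generated_by_topspace by (auto intro: exI[of _ UNIV])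
  show "continuous_map weak_star_topology weak_topology L"
    unfolding weak_topology_def
  proof (rule continuous_on_generated_topo)
    fix N :: "'w set" assume "N \<in> {{x. dual_apply f x \<in> U} | f U. open U}"
    then obtain g U where N: "N = {x. dual_apply g x \<in> U}" and U: "open U" by blast
    have "L v'' \<in> N \<longleftrightarrow> dual_apply v'' (Dual (\<lambda>v. dual_apply g (L (canonical v)))) \<in> U" for v''
      using eq[rule_format, of g v''] by (simp add: N)
    then have "L -` N = {v''. dual_apply v'' (Dual (\<lambda>v. dual_apply g (L (canonical v)))) \<in> U}"
      by blast
    also have "openin weak_star_topology \<dots>"
      unfolding weak_star_topology_def using U by (intro topology_generated_by_Basis) auto
    finally show "openin weak_star_topology (L -` N \<inter> topspace weak_star_topology)"
      by (simp add: top')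
  next
    have "UNIV \<in> {{x :: 'w. dual_apply f x \<in> U} | f U. open U}"
      using open_UNIV by blast
    then show "L ` topspace weak_star_topology \<subseteq> \<Union>{{x. dual_apply f x \<in> U} | f U. open U}"
      by blast
  qed
qed


section \<open>The extended module operations and the derivation rule\<close>

lemma bounded_cbilinear_bidual_ext:
  fixes m :: "'u::complex_normed_vector \<Rightarrow> 'v::complex_normed_vector \<Rightarrow> 'w::complex_normed_vector"
  assumes m: "bounded_cbilinear m"
  shows "bounded_cbilinear (bidual_ext m)"
proof -
  obtain K where K: "K \<ge> 0" "\<And>u v. norm (m u v) \<le> norm u * norm v * K"
    using bounded_cbilinear_bound[OF m] by blast
  define G where "G v'' w' = Dual (\<lambda>u. dual_apply v'' (adjoint_map (m u) w'))" for v'' w'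
  have G: "dual_apply (G v'' w') u = dual_apply v'' (adjoint_map (m u) w')" for v'' w' u
    unfolding G_def by (rule dual_apply_Dual[OF bidual_ext_inner(2)[OF m]])
  have ext_apply: "dual_apply (bidual_ext m u'' v'') w' = dual_apply u'' (G v'' w')" for u'' v'' w'
    by (simp add: bidual_ext_apply[OF m] G_def)
  have Gadd: "G (v + v') w' = G v w' + G v' w'" and Gscale: "G (c *\<^sub>C v) w' = c *\<^sub>C G v w'"
    for v v' w' c
    by (rule dual_eqI, simp add: G dual_plus_apply dual_scaleC_apply)+
  have normG: "norm (G v'' w') \<le> norm v'' * norm w' * K" for v'' w'
  proof (rule norm_dual_le)
    fix u
    have "norm (adjoint_map (m u) w') \<le> norm w' * norm u * K"
    proof (rule norm_dual_le)
      fix v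
      have "cmod (dual_apply w' (m u v)) \<le> norm w' * norm (m u v)" by (rule norm_dual_apply_le)
      also have "\<dots> \<le> norm w' * (norm u * norm v * K)" by (intro mult_left_mono K) simp
      finally show "cmod (dual_apply (adjoint_map (m u) w') v) \<le> norm w' * norm u * K * norm v"
        by (simp add: adjoint_map_apply[OF bounded_cbilinear_right[OF m]] mult_ac)
    qed (simp add: K)
    then have "norm v'' * norm (adjoint_map (m u) w') \<le> norm v'' * (norm w' * norm u * K)"
      by (intro mult_left_mono) auto
    then show "cmod (dual_apply (G v'' w') u) \<le> norm v'' * norm w' * K * norm u"
      unfolding G using norm_dual_apply_le[of v'' "adjoint_map (m u) w'"] by (simp add: mult_ac)
  qed (simp add: K)
  have norm: "norm (bidual_ext m u'' v'') \<le> norm u'' * norm v'' * K" for u'' v''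
  proof (rule norm_dual_le)
    fix w'
    have "norm u'' * norm (G v'' w') \<le> norm u'' * (norm v'' * norm w' * K)"
      by (intro mult_left_mono normG) simp
    then show "cmod (dual_apply (bidual_ext m u'' v'') w') \<le> norm u'' * norm v'' * K * norm w'"
      unfolding ext_apply using norm_dual_apply_le[of u'' "G v'' w'"] by (simp add: mult_ac)
  qed (simp add: K)
  have add: "bidual_ext m (u + u') v = bidual_ext m u v + bidual_ext m u' v"
    "bidual_ext m u (v + v') = bidual_ext m u v + bidual_ext m u v'" for u u' v v'
    by (rule dual_eqI, simp add: ext_apply Gadd dual_plus_apply dual_apply_add)+
  have scale: "bidual_ext m (c *\<^sub>C u) v = c *\<^sub>C bidual_ext m u v"
    "bidual_ext m u (c *\<^sub>C v) = c *\<^sub>C bidual_ext m u v" for u v c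
    by (rule dual_eqI, simp add: ext_apply Gscale dual_scaleC_apply dual_apply_scaleC)+
  have "bounded_bilinear (bidual_ext m)"
    by standard (auto simp: add scale scaleR_scaleC intro: norm)
  with scale show ?thesis by (simp add: bounded_cbilinear_def)
qed

text \<open>
  For \<open>a\<close> in the algebra itself no limit is involved: right multiplication by \<open>a\<close> on the bidual of the
  module is the second adjoint of right multiplication on the module.
\<close>

lemma bidual_ext_canonical_right:
  assumes "bounded_cbilinear ract"
  shows "dual_apply (bidual_ext ract x'' (canonical a)) f = dual_apply x'' (dual_lact ract a f)"
  by (simp add: bidual_ext_apply[OF assms] canonical_apply dual_lact_def
      adjoint_map_apply[OF bounded_cbilinear_right[OF assms]])

text \<open>
  The first summand comes from \<open>a \<cdot> D b\<close>. It would be \<open>\<langle>D'' b'', x'' a''\<rangle>\<close> if the outer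
  limit over \<open>a\<close> could be taken inside \<open>D'' b''\<close>; but \<open>x'' a\<close> tends to \<open>x'' a''\<close> only in the weak-star
  topology, for which \<open>D'' b''\<close> need not be continuous. In the second summand, from \<open>D a \<cdot> b\<close>, the
  inner limit over \<open>b\<close> already produces \<open>b'' x''\<close>, and the outer one is harmless because it is tested
  on the fixed functional \<open>D' (b'' x'')\<close>.
\<close>

lemma biadjoint_derivation_product:
  fixes lact :: "'a::{complex_normed_algebra,banach} \<Rightarrow> 'x::{complex_normed_vector,banach} \<Rightarrow> 'x"
  assumes lact: "bounded_cbilinear lact" and ract: "bounded_cbilinear ract"
    and der: "derivation (*) (dual_lact ract) (dual_ract lact) D"
  shows "dual_apply (adjoint_map (adjoint_map D) (arens_first a'' b'')) x'' =
    dual_apply a'' (Dual (\<lambda>a. dual_apply (adjoint_map (adjoint_map D) b'')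
      (bidual_ext ract x'' (canonical a)))) +
    dual_apply (adjoint_map (adjoint_map D) a'') (bidual_ext lact b'' x'')"
proof -
  have D: "bounded_clinear D" and prod: "D (a * b) = dual_lact ract a (D b) + dual_ract lact (D a) b" for a b
    using der by (auto simp: derivation_def)
  have D': "bounded_clinear (adjoint_map D)" by (rule bounded_clinear_adjoint[OF D])
  note app = adjoint_map_apply[OF D'] adjoint_map_apply[OF D]
  let ?T = "adjoint_map D"
  note rcl = bounded_cbilinear_right[OF bounded_cbilinear_bidual_ext[OF ract]]
  have inner: "bounded_clinear (\<lambda>z. dual_apply x'' (adjoint_map (lact z) (D a)))" for a
    by (rule bidual_ext_inner(2)[OF lact])
  have right_act: "dual_ract lact f z = adjoint_map (lact z) f" for f z
    by (simp add: dual_ract_def adjoint_map_def)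
  have split: "adjoint_map ((*) a) (?T x'') = ?T (bidual_ext ract x'' (canonical a)) +
      Dual (\<lambda>z. dual_apply x'' (adjoint_map (lact z) (D a)))" for a
    by (rule dual_eqI)
      (simp add: adjoint_map_apply[OF bounded_cbilinear_right[OF bounded_cbilinear_mult]] app prod
        dual_apply_add dual_plus_apply bidual_ext_canonical_right[OF ract] dual_apply_Dual[OF inner]
        right_act)
  have cl: "bounded_clinear (\<lambda>a. dual_apply b'' (?T (bidual_ext ract x'' (canonical a))))"
    by (rule bounded_clinear_compose[OF dual_apply_bounded_clinear bounded_clinear_compose[OF D'
          bounded_clinear_compose[OF rcl bounded_clinear_canonical]]])
  have "Dual (\<lambda>a. dual_apply b'' (adjoint_map ((*) a) (?T x''))) =
      Dual (\<lambda>a. dual_apply b'' (?T (bidual_ext ract x'' (canonical a)))) + ?T (bidual_ext lact b'' x'')"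
    by (rule dual_eqI)
      (simp only: dual_apply_Dual[OF bidual_ext_inner(2)[OF bounded_cbilinear_mult]]
        dual_plus_apply dual_apply_Dual[OF cl], simp add: split dual_apply_add app
        bidual_ext_apply[OF lact])
  then show ?thesis
    by (simp add: app arens_first_eq_bidual_ext bidual_ext_apply[OF bounded_cbilinear_mult]
        dual_apply_add)
qed

theorem mainTheorem5:
  fixes lact :: "'a::{complex_normed_algebra,banach} \<Rightarrow> 'x::{complex_normed_vector,banach} \<Rightarrow> 'x"
    and ract :: "'x \<Rightarrow> 'a \<Rightarrow> 'x"
    and D :: "'a \<Rightarrow> 'x dual"
  assumes "arens_regular TYPE('a)"
    and "banach_bimodule (*) lact ract"
    and "derivation (*) (dual_lact ract) (dual_ract lact) D"
    and "surj D"
  shows "derivation arens_first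
           (dual_lact (bidual_ext ract)) (dual_ract (bidual_ext lact))
           (adjoint_map (adjoint_map D))
         \<longleftrightarrow>
         (\<forall>x'' :: 'x dual dual.
           continuous_map weak_star_topology weak_topology (\<lambda>a''. bidual_ext ract x'' a''))"
proof -
  have lact: "bounded_cbilinear lact" and ract: "bounded_cbilinear ract"
    using assms(2) by (auto simp: banach_bimodule_def)
  have D: "bounded_clinear D" using assms(3) by (simp add: derivation_def)
  let ?D = "adjoint_map (adjoint_map D)"
  have D'': "bounded_clinear ?D" by (intro bounded_clinear_adjoint D)
  note lact'' = bounded_cbilinear_bidual_ext[OF lact]
  note ract'' = bounded_cbilinear_bidual_ext[OF ract]
  let ?\<phi> = "\<lambda>g x''. Dual (\<lambda>a. dual_apply g (bidual_ext ract x'' (canonical a)))"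
  have "derivation arens_first (dual_lact (bidual_ext ract)) (dual_ract (bidual_ext lact)) ?D \<longleftrightarrow>
      (\<forall>a'' b'' x''. dual_apply (?D (arens_first a'' b'')) x'' =
        dual_apply (?D b'') (bidual_ext ract x'' a'') + dual_apply (?D a'') (bidual_ext lact b'' x''))"
    by (simp add: derivation_def D'' dual_apply_inject[symmetric] fun_eq_iff dual_plus_apply
        dual_lact_apply[OF bounded_cbilinear_left[OF ract'']]
        dual_ract_apply[OF bounded_cbilinear_right[OF lact'']])
  also have "\<dots> \<longleftrightarrow> (\<forall>a'' b'' x''.
      dual_apply a'' (?\<phi> (?D b'') x'') = dual_apply (?D b'') (bidual_ext ract x'' a''))"
    by (simp only: biadjoint_derivation_product[OF lact ract assms(3)] add_right_cancel)
  also have "\<dots> \<longleftrightarrow> (\<forall>x'' g a''. dual_apply g (bidual_ext ract x'' a'') = dual_apply a'' (?\<phi> g x''))"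
  proof (intro iffI allI)
    fix x'' g a''
    obtain b'' where g: "g = ?D b''" using surj_biadjoint[OF D assms(4)] by blast
    assume "\<forall>a'' b'' x''.
      dual_apply a'' (?\<phi> (?D b'') x'') = dual_apply (?D b'') (bidual_ext ract x'' a'')"
    then show "dual_apply g (bidual_ext ract x'' a'') = dual_apply a'' (?\<phi> g x'')"
      unfolding g by (elim allE) (rule sym)
  next
    fix a'' b'' x''
    assume "\<forall>x'' g a''. dual_apply g (bidual_ext ract x'' a'') = dual_apply a'' (?\<phi> g x'')"
    then show "dual_apply a'' (?\<phi> (?D b'') x'') = dual_apply (?D b'') (bidual_ext ract x'' a'')"
      by (elim allE) (rule sym)
  qed
  also have "\<dots> \<longleftrightarrow> (\<forall>x''. continuous_map weak_star_topology weak_topology (bidual_ext ract x''))"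
    by (simp only: continuous_map_weak_star_weak_iff[OF bounded_cbilinear_right[OF ract'']])
  finally show ?thesis .
qed

end
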